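(* Let $d_A,d_B\ge 1$ be integers, $n=d_Ad_B$, and let $\rho(t)$ be a family of density matrices on $\mathbb{C}^{d_A}\otimes\mathbb{C}^{d_B}$, depending twice differentiably on a real parameter $t$ in a neighbourhood of $t_0$, with derivatives $\dot\rho(t_0)$ and $\ddot\rho(t_0)$ at $t_0$. Assume that the partial transpose $\rho^{T_B}(t_0)$ is invertible, and let $\rho^{T_B}(t_0)=U\Lambda U^\dagger$ be an eigendecomposition, with $U$ unitary and $\Lambda$ real diagonal. Then the negativity $\mathcal{N}(t)=\mathcal{N}(\rho(t))$ is twice differentiable at $t_0$ and $$\left.\frac{d^2\mathcal{N}}{dt^2}\right|_{t=t_0}=\frac12\left[K_B\,\mathrm{vec}\,\dot\rho(t_0)\right]^T \mathcal{H}\left[K_B\,\mathrm{vec}\,\dot\rho(t_0)\right]+\frac12\,\mathrm{vec}^T\!\left[U^{*}\,\mathrm{sign}(\Lambda)\,U^{T}\right]K_B\,\mathrm{vec}\,\ddot\rho(t_0),$$ where $$\mathcal{H}=K\,(U^*\otimes U)\left[I_{n^2}-\mathrm{sign}(\Lambda)\otimes\mathrm{sign}(\Lambda)\right]\left(|\Lambda|\otimes I_n+I_n\otimes|\Lambda|\right)^{-1}(U^T\otimes U^\dagger).$$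
   Context: A density matrix on $\mathbb{C}^{d_A}\otimes\mathbb{C}^{d_B}$ is a positive semidefinite Hermitian $d_Ad_B\times d_Ad_B$ complex matrix of unit trace. The partial transpose $X\mapsto X^{T_B}$ is the complex-linear map on $d_Ad_B\times d_Ad_B$ matrices with $(Y\otimes Z)^{T_B}=Y\otimes Z^T$ for $Y$ of size $d_A\times d_A$ and $Z$ of size $d_B\times d_B$. The trace norm is $\|X\|_1=\mathrm{Tr}\sqrt{X^\dagger X}$, and the negativity of a density matrix $\rho$ is $\mathcal{N}(\rho)=\tfrac12(\|\rho^{T_B}\|_1-1)$. For a matrix $X$, $X^*$ is the entrywise complex conjugate, $X^\dagger=(X^* )^T$, $\mathrm{vec}\,X$ is the column vector obtained by stacking the columns of $X$, and $\mathrm{vec}^TX=(\mathrm{vec}\,X)^T$. For a real diagonal matrix $\Lambda$, $\mathrm{sign}(\Lambda)$ and $|\Lambda|$ are the diagonal matrices of the signs and of the absolute values of its entries. $J_m^{ij}$ is the $m\times m$ matrix with $(J_m^{ij})_{kl}=\delta_{ik}\delta_{jl}$, $I_m$ is the $m\times m$ identity, $\otimes$ is the Kronecker product, $$K=\sum_{i,j=1}^{n}J_n^{ji}\otimes J_n^{ij},\qquad K_B=\sum_{i,j=1}^{d_B}\left(I_{d_A}\otimes J_{d_B}^{ji}\right)\otimes\left(I_{d_A}\otimes J_{d_B}^{ij}\right).$$ *)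

theory Defs
  imports "HOL-Analysis.Analysis"
begin

(* The spaces C^dA and C^dB are complex^'a and complex^'b with dA = CARD('a) and dB = CARD('b).
   Tensor products are indexed by pairs; a pair (i, k) stands for the position (i - 1) * d2 + k
   of the usual Kronecker ordering. Note that the type complex^'n^'m has 'm as its row index. *)

definition cnj_mat :: "complex^'n^'m \<Rightarrow> complex^'n^'m"
  where "cnj_mat X = map_matrix cnj X"

definition dagger :: "complex^'n^'m \<Rightarrow> complex^'m^'n"
  where "dagger X = transpose (cnj_mat X)"

definition hermitian :: "complex^'n^'n \<Rightarrow> bool"
  where "hermitian X \<longleftrightarrow> dagger X = X"

definition unitary :: "complex^'n^'n \<Rightarrow> bool"
  where "unitary U \<longleftrightarrow> dagger U ** U = mat 1 \<and> U ** dagger U = mat 1"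

(* The quadratic form of a Hermitian matrix is real, so taking its real part loses nothing. *)
definition psd :: "complex^'n^'n \<Rightarrow> bool"
  where "psd X \<longleftrightarrow> hermitian X \<and> (\<forall>v. 0 \<le> Re (\<Sum>i\<in>UNIV. cnj (v $ i) * (X *v v) $ i))"

definition density_matrix :: "complex^'n^'n \<Rightarrow> bool"
  where "density_matrix X \<longleftrightarrow> psd X \<and> trace X = 1"

definition kron :: "complex^'n^'m \<Rightarrow> complex^'q^'p \<Rightarrow> complex^('n \<times> 'q::finite)^('m \<times> 'p)"
  where "kron Y Z = (\<chi> r c. Y $ fst r $ fst c * Z $ snd r $ snd c)"

definition partial_transpose :: "complex^('a::finite \<times> 'b::finite)^('a \<times> 'b) \<Rightarrow> complex^('a \<times> 'b)^('a \<times> 'b)"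
  where "partial_transpose X = (\<chi> r c. X $ (fst r, snd c) $ (fst c, snd r))"

(* The unique positive semidefinite square root of a positive semidefinite matrix. *)
definition psd_sqrt :: "complex^'n^'n \<Rightarrow> complex^'n^'n"
  where "psd_sqrt A = (THE R. psd R \<and> R ** R = A)"

(* The trace of a positive semidefinite matrix is real. *)
definition trace_norm :: "complex^'n^'n \<Rightarrow> real"
  where "trace_norm X = Re (trace (psd_sqrt (dagger X ** X)))"

definition negativity :: "complex^('a::finite \<times> 'b::finite)^('a \<times> 'b) \<Rightarrow> real"
  where "negativity X = (trace_norm (partial_transpose X) - 1) / 2"

(* Column stacking: the column index comes first, since it is the more significant one in the
   ordering of pairs. *)
definition vec_mat :: "complex^'n^'m \<Rightarrow> complex^('n::finite \<times> 'm::finite)"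
  where "vec_mat X = (\<chi> p. X $ snd p $ fst p)"

(* The bilinear product v^T w, without complex conjugation. *)
definition tdot :: "complex^'n \<Rightarrow> complex^'n \<Rightarrow> complex"
  where "tdot v w = (\<Sum>i\<in>UNIV. v $ i * w $ i)"

definition diag_mat :: "real^'n \<Rightarrow> complex^'n^'n"
  where "diag_mat l = (\<chi> i j. if i = j then complex_of_real (l $ i) else 0)"

(* sign(L) and |L| for the real diagonal matrix L = diag_mat l *)
definition sign_diag :: "real^'n \<Rightarrow> complex^'n^'n"
  where "sign_diag l = diag_mat (\<chi> i. sgn (l $ i))"

definition abs_diag :: "real^'n \<Rightarrow> complex^'n^'n"
  where "abs_diag l = diag_mat (\<chi> i. \<bar>l $ i\<bar>)"

definition unit_mat :: "'n \<Rightarrow> 'n \<Rightarrow> complex^'n^'n"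
  where "unit_mat i j = (\<chi> k l. if i = k \<and> j = l then 1 else 0)"

definition K_mat :: "complex^('n::finite \<times> 'n)^('n \<times> 'n)"
  where "K_mat = (\<Sum>i\<in>UNIV. \<Sum>j\<in>UNIV. kron (unit_mat j i) (unit_mat i j))"

definition KB_mat :: "complex^(('a::finite \<times> 'b::finite) \<times> ('a \<times> 'b))^(('a \<times> 'b) \<times> ('a \<times> 'b))"
  where "KB_mat = (\<Sum>i\<in>UNIV. \<Sum>j\<in>UNIV.
    kron (kron (mat 1) (unit_mat j i)) (kron (mat 1) (unit_mat i j)))"

definition H_mat :: "complex^'n^'n \<Rightarrow> real^'n \<Rightarrow> complex^('n::finite \<times> 'n)^('n \<times> 'n)"
  where "H_mat U l =
    K_mat ** kron (cnj_mat U) U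
      ** (mat 1 - kron (sign_diag l) (sign_diag l))
      ** matrix_inv (kron (abs_diag l) (mat 1) + kron (mat 1) (abs_diag l))
      ** kron (transpose U) (dagger U)"

(* The entrywise definition of the partial transpose agrees with its defining property: it is the
   only complex-linear map that sends kron Y Z to kron Y (transpose Z). *)

lemma partial_transpose_kron: "partial_transpose (kron Y Z) = kron Y (transpose Z)"
  by (simp add: partial_transpose_def kron_def transpose_def vec_eq_iff)

lemma partial_transpose_add: "partial_transpose (X + Y) = partial_transpose X + partial_transpose Y"
  by (simp add: partial_transpose_def vec_eq_iff)

lemma partial_transpose_scale:
  "partial_transpose (map_matrix ((*) c) X) = map_matrix ((*) c) (partial_transpose X)"
  by (simp add: partial_transpose_def vec_eq_iff)

lemma partial_transpose_unique:
  fixes f :: "complex^('a::finite \<times> 'b::finite)^('a \<times> 'b) \<Rightarrow> complex^('a \<times> 'b)^('a \<times> 'b)"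
  assumes add: "\<And>X Y. f (X + Y) = f X + f Y"
    and scale: "\<And>c X. f (map_matrix ((*) c) X) = map_matrix ((*) c) (f X)"
    and kron: "\<And>Y Z. f (kron Y Z) = kron Y (transpose Z)"
  shows "f = partial_transpose"
proof
  fix X :: "complex^('a::finite \<times> 'b::finite)^('a \<times> 'b)"
  have zero: "map_matrix ((*) 0) Y = 0" for Y :: "complex^('a::finite \<times> 'b::finite)^('a \<times> 'b)"
    by (simp add: vec_eq_iff)
  have f0: "f 0 = 0"
    using scale[of 0 0] zero by metis
  have p0: "partial_transpose (0 :: complex^('a::finite \<times> 'b::finite)^('a \<times> 'b)) = 0"
    by (simp add: partial_transpose_def vec_eq_iff)
  have fsum: "f (sum g S) = (\<Sum>x\<in>S. f (g x))" if "finite S"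
    for g :: "(('a \<times> 'b) \<times> ('a \<times> 'b)) \<Rightarrow> _" and S
    using that by (induction) (auto simp: f0 add)
  have psum: "partial_transpose (sum g S) = (\<Sum>x\<in>S. partial_transpose (g x))" if "finite S"
    for g :: "(('a \<times> 'b) \<times> ('a \<times> 'b)) \<Rightarrow> complex^('a::finite \<times> 'b::finite)^('a \<times> 'b)" and S
    using that by (induction) (auto simp: p0 partial_transpose_add)
  define g where "g = (\<lambda>(r, c). map_matrix ((*) (X $ r $ c))
    (kron (unit_mat (fst r) (fst c)) (unit_mat (snd r) (snd c))))"
  have g_entry: "g x $ r $ c = (if x = (r, c) then X $ r $ c else 0)" for x r c
    by (auto simp: g_def kron_def unit_mat_def split: prod.splits)
  have X: "X = sum g UNIV"
    by (simp add: vec_eq_iff g_entry)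
  have "f (g x) = partial_transpose (g x)" for x
    by (cases x) (simp add: g_def scale kron partial_transpose_scale partial_transpose_kron)
  then show "f X = partial_transpose X"
    by (subst (1 2) X) (simp add: fsum psum)
qed

end

theory Submission
  imports Defs
begin

text \<open>
  Conjugating by \<open>U\<close> turns the partial transpose into a Hermitian curve \<open>A\<close> with \<open>A(t\<^sub>0) = \<Lambda>\<close>.
  The inverse function theorem for \<open>R \<mapsto> R\<^sup>2\<close> near \<open>|\<Lambda>|\<close> yields a differentiable positive definite
  root \<open>R\<close> of \<open>A\<^sup>2\<close>, and the trace norm is \<open>tr R\<close>. From \<open>R R' + R' R = A A' + A' A\<close> one gets
  \<open>tr R' = tr (R\<^sup>-\<^sup>1 (A A' + A' A)) / 2\<close>, an expression that can be differentiated once more without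
  knowing that \<open>R'\<close> is differentiable. At \<open>t\<^sub>0\<close> all matrices but \<open>A'\<close> and \<open>A''\<close> are diagonal and \<open>R'\<close>
  is explicit; symmetrising the resulting double sum gives the kernel
  \<open>(1 - s\<^sub>i s\<^sub>j) / (|\<lambda>\<^sub>i| + |\<lambda>\<^sub>j|)\<close> of \<open>\<H>\<close>.
\<close>

section \<open>Linearity and adjoints of matrix operations\<close>

lemma bounded_bilinear_matrix_mult:
  "bounded_bilinear ((**) :: complex^'n^'m \<Rightarrow> complex^'p^'n \<Rightarrow> complex^'p^'m)"
proof -
  have "bilinear ((**) :: complex^'n^'m \<Rightarrow> complex^'p^'n \<Rightarrow> complex^'p^'m)"
    unfolding bilinear_def
    by (intro conjI allI linearI)
      (simp_all add: vec_eq_iff matrix_matrix_mult_def algebra_simps sum.distrib scaleR_sum_right)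
  then show ?thesis
    by (simp add: bilinear_conv_bounded_bilinear)
qed

lemma bounded_linear_trace: "bounded_linear (trace :: complex^'n^'n \<Rightarrow> complex)"
  unfolding linear_conv_bounded_linear[symmetric]
  by (intro linearI) (simp_all add: trace_def sum.distrib scaleR_sum_right)

lemma dagger_nth [simp]: "dagger X $ i $ j = cnj (X $ j $ i)"
  by (simp add: dagger_def cnj_mat_def transpose_def)

lemma dagger_dagger [simp]: "dagger (dagger X) = X"
  by (simp add: vec_eq_iff)

lemma dagger_mult: "dagger (X ** Y) = dagger Y ** dagger X"
  by (simp add: vec_eq_iff matrix_matrix_mult_def mult.commute)

lemma dagger_diff: "dagger (X - Y) = dagger X - dagger Y"
  by (simp add: vec_eq_iff)

lemma bounded_linear_dagger: "bounded_linear (dagger :: complex^'n^'m \<Rightarrow> complex^'m^'n)"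
  unfolding linear_conv_bounded_linear[symmetric]
  by (intro linearI) (simp_all add: vec_eq_iff)

lemma bounded_linear_partial_transpose: "bounded_linear partial_transpose"
  unfolding linear_conv_bounded_linear[symmetric]
  by (intro linearI) (simp_all add: vec_eq_iff partial_transpose_def)

lemma hermitian_partial_transpose: "hermitian X \<Longrightarrow> hermitian (partial_transpose X)"
  by (simp add: hermitian_def vec_eq_iff partial_transpose_def)

lemma trace_hermitian_real: "hermitian X \<Longrightarrow> complex_of_real (Re (trace X)) = trace X"
  unfolding hermitian_def vec_eq_iff trace_def
  by (simp add: complex_eq_iff) (metis (no_types, lifting) cnj.sel(2) sum.neutral equal_neg_zero)

lemma diag_mat_nth: "diag_mat l $ i $ j = (if i = j then complex_of_real (l $ i) else 0)"
  by (simp add: diag_mat_def)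

lemma diag_mat_mult_nth: "(diag_mat l ** X) $ i $ j = of_real (l $ i) * X $ i $ j"
  by (simp add: matrix_matrix_mult_def diag_mat_nth if_distrib[of "\<lambda>x. x * _"] cong: if_cong)

lemma mult_diag_mat_nth: "(X ** diag_mat l) $ i $ j = X $ i $ j * of_real (l $ j)"
  by (simp add: matrix_matrix_mult_def diag_mat_nth if_distrib[of "\<lambda>x. _ * x"] cong: if_cong)

section \<open>Positive definiteness and uniqueness of square roots\<close>

definition herm_form :: "complex^'n^'n \<Rightarrow> complex^'n \<Rightarrow> real"
  where "herm_form X v = Re (\<Sum>i\<in>UNIV. cnj (v $ i) * (X *v v) $ i)"

text \<open>Unlike \<open>psd\<close>, this forces invertibility and persists under small Hermitian
  perturbations.\<close>

definition posdef :: "complex^'n^'n \<Rightarrow> bool"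
  where "posdef X \<longleftrightarrow> hermitian X \<and> (\<forall>v. v \<noteq> 0 \<longrightarrow> 0 < herm_form X v)"

lemma psd_iff_herm_form: "psd X \<longleftrightarrow> hermitian X \<and> (\<forall>v. 0 \<le> herm_form X v)"
  by (simp add: psd_def herm_form_def)

lemma herm_form_zero [simp]: "herm_form X 0 = 0"
  by (simp add: herm_form_def)

lemma posdef_imp_psd: "posdef X \<Longrightarrow> psd X"
  unfolding posdef_def psd_iff_herm_form by (metis herm_form_zero less_imp_le order_refl)

lemma herm_form_conjugate: "herm_form (U ** X ** dagger U) v = herm_form X (dagger U *v v)"
proof -
  have "(\<Sum>i\<in>UNIV. cnj (v $ i) * (U *v y) $ i) = (\<Sum>j\<in>UNIV. cnj ((dagger U *v v) $ j) * y $ j)"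
    for y
    unfolding matrix_vector_mult_def
    by (simp add: sum_distrib_left sum_distrib_right)
      (subst sum.swap, simp add: ac_simps)
  then show ?thesis
    by (simp add: herm_form_def matrix_vector_mul_assoc[symmetric])
qed

lemma posdef_conjugate:
  assumes "unitary U" "posdef X"
  shows "posdef (U ** X ** dagger U)"
proof -
  have "dagger U *v v \<noteq> 0" if "v \<noteq> 0" for v
  proof
    assume "dagger U *v v = 0"
    then have "(U ** dagger U) *v v = 0"
      by (simp add: matrix_vector_mul_assoc[symmetric])
    then show False
      using assms(1) that by (simp add: unitary_def)
  qed
  then show ?thesis
    using assms(2)
    by (auto simp: posdef_def herm_form_conjugate hermitian_def dagger_mult matrix_mul_assoc)
qed

lemma posdef_imp_invertible: "posdef X \<Longrightarrow> invertible X"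
  unfolding invertible_left_inverse matrix_left_invertible_ker posdef_def herm_form_def
  by fastforce

text \<open>Each diagonal entry of \<open>dagger D ** X ** D\<close> is the form of \<open>X\<close>
  at a column of \<open>D\<close>, so positivity of \<open>X\<close> passes to the trace.\<close>

lemma trace_dagger_mult_mult:
  "Re (trace (dagger D ** X ** D)) = (\<Sum>j\<in>UNIV. herm_form X (column j D))"
proof -
  have "(dagger D ** (X ** D)) $ j $ j
      = (\<Sum>i\<in>UNIV. cnj (column j D $ i) * (X *v column j D) $ i)" for j
    by (simp add: matrix_matrix_mult_def matrix_vector_mult_def column_def)
  then show ?thesis
    by (simp only: trace_def herm_form_def matrix_mul_assoc[symmetric] Re_sum)
qed

lemma posdef_sqrt_unique:
  assumes P: "psd P" and Q: "posdef Q" and eq: "P ** P = Q ** Q"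
  shows "P = Q"
proof -
  \<comment> \<open>\<open>P D + D Q = 0\<close> makes the traces of \<open>D P D\<close> and \<open>D Q D\<close>, both nonnegative, sum to zero.\<close>
  define D where "D = P - Q"
  have D: "dagger D = D"
    using P Q by (simp add: D_def dagger_diff psd_def posdef_def hermitian_def)
  have 0: "P ** D + D ** Q = 0"
    by (simp add: D_def eq bounded_bilinear.diff_left[OF bounded_bilinear_matrix_mult]
        bounded_bilinear.diff_right[OF bounded_bilinear_matrix_mult])
  have "trace (D ** P ** D) + trace (D ** Q ** D) = trace (D ** (P ** D + D ** Q))"
    unfolding matrix_add_ldistrib trace_add matrix_mul_assoc
    using trace_mul_sym[of D "D ** Q"] by (simp only: matrix_mul_assoc)
  then have "Re (trace (dagger D ** P ** D)) + Re (trace (dagger D ** Q ** D)) = 0"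
    by (simp add: D 0 trace_0[unfolded mat_0] flip: plus_complex.sel)
  moreover have "0 \<le> Re (trace (dagger D ** P ** D))"
    using P by (simp add: trace_dagger_mult_mult psd_iff_herm_form sum_nonneg)
  ultimately have "(\<Sum>j\<in>UNIV. herm_form Q (column j D)) \<le> 0"
    by (simp add: trace_dagger_mult_mult)
  moreover have nn: "0 \<le> herm_form Q (column j D)" for j
    using posdef_imp_psd[OF Q] by (simp add: psd_iff_herm_form)
  ultimately have "herm_form Q (column j D) = 0" for j
    by (metis (mono_tags, lifting) UNIV_I antisym finite sum_nonneg sum_nonneg_eq_0_iff)
  then have "column j D = 0" for j
    using Q unfolding posdef_def by (metis less_irrefl)
  then show ?thesis
    by (simp add: D_def column_def vec_eq_iff)
qed

text \<open>\<open>R\<close> itself gives existence, and comparing any psd root with the positive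
  definite \<open>R\<close> gives uniqueness; this settles the definite description.\<close>

lemma psd_sqrt_eqI:
  assumes "posdef R" "R ** R = X"
  shows "psd_sqrt X = R"
  unfolding psd_sqrt_def
  using assms by (intro the_equality) (auto intro: posdef_imp_psd posdef_sqrt_unique)

section \<open>Differentiating determinants and matrix inverses\<close>

lemma has_derivative_vecI:
  fixes f :: "'a::real_normed_vector \<Rightarrow> 'b::euclidean_space^'n"
  assumes "\<And>i. ((\<lambda>x. f x $ i) has_derivative (\<lambda>h. f' h $ i)) (at x within S)"
  shows "(f has_derivative f') (at x within S)"
  by (subst has_derivative_componentwise_within)
    (auto simp: Basis_vec_def inner_axis intro!: has_derivative_inner_left assms)

lemma differentiable_vecI:
  fixes f :: "'a::real_normed_vector \<Rightarrow> 'b::euclidean_space^'n"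
  assumes "\<And>i. (\<lambda>x. f x $ i) differentiable (at x within S)"
  shows "f differentiable (at x within S)"
proof -
  obtain f' where "\<And>i. ((\<lambda>x. f x $ i) has_derivative f' i) (at x within S)"
    using assms unfolding differentiable_def by metis
  then have "(f has_derivative (\<lambda>h. \<chi> i. f' i h)) (at x within S)"
    by (intro has_derivative_vecI) simp
  then show ?thesis
    by (auto simp: differentiable_def)
qed

lemma differentiable_vec_nth:
  assumes "f differentiable F"
  shows "(\<lambda>x. f x $ i) differentiable F"
  using assms unfolding differentiable_def
  by (auto dest: bounded_linear.has_derivative[OF bounded_linear_vec_nth])

lemma differentiable_prod:
  fixes f :: "'i \<Rightarrow> 'a::real_normed_vector \<Rightarrow> 'b::real_normed_field"
  assumes "\<And>i. i \<in> I \<Longrightarrow> f i differentiable (at x within S)"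
  shows "(\<lambda>x. \<Prod>i\<in>I. f i x) differentiable (at x within S)"
proof -
  obtain f' where "\<And>i. i \<in> I \<Longrightarrow> (f i has_derivative f' i) (at x within S)"
    using assms unfolding differentiable_def by metis
  then show ?thesis
    unfolding differentiable_def using has_derivative_prod[of I f f' x S] by blast
qed

lemma differentiable_det:
  fixes M :: "'a::real_normed_vector \<Rightarrow> complex^'n^'n"
  assumes "\<And>i j. (\<lambda>x. M x $ i $ j) differentiable (at x within S)"
  shows "(\<lambda>x. det (M x)) differentiable (at x within S)"
  unfolding det_def
  by (intro differentiable_sum differentiable_mult differentiable_prod differentiable_const ballI
      assms) (simp add: finite_permutations)

lemma
  fixes A :: "'a::semiring_1^'n^'n"
  assumes "invertible A"
  shows matrix_inv_right: "A ** matrix_inv A = mat 1"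
    and matrix_inv_left: "matrix_inv A ** A = mat 1"
  using someI_ex[OF assms[unfolded invertible_def]] by (simp_all add: matrix_inv_def)

text \<open>Column \<open>j\<close> of the inverse solves \<open>M *v x = axis j 1\<close>. The
  quotient of determinants makes the smooth dependence on the entries of \<open>M\<close>
  visible.\<close>

lemma matrix_inv_nth_cramer:
  fixes M :: "'a::field^'n^'n"
  assumes "det M \<noteq> 0"
  shows "matrix_inv M $ k $ j
    = det (\<chi> i j'. if j' = k then axis j 1 $ i else M $ i $ j') / det M"
proof -
  have "M ** matrix_inv M = mat 1"
    using assms by (simp add: invertible_det_nz[symmetric] matrix_inv_right)
  then have "M *v (matrix_inv M *v axis j 1) = axis j 1"
    by (simp add: matrix_vector_mul_assoc)
  then have "matrix_inv M *v axis j 1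
      = (\<chi> k. det (\<chi> i j'. if j' = k then axis j 1 $ i else M $ i $ j') / det M)"
    using cramer[OF assms] by blast
  moreover have "(matrix_inv M *v axis j 1) $ k = matrix_inv M $ k $ j"
    by (simp add: matrix_vector_mult_def axis_def if_distrib[of "\<lambda>x. _ * x"] cong: if_cong)
  ultimately show ?thesis
    by simp
qed

text \<open>Cramer's rule gives existence of the derivative; its value follows by differentiating
  \<open>matrix_inv (M s) ** M s = mat 1\<close>.\<close>

lemma has_vector_derivative_matrix_inv:
  fixes M :: "real \<Rightarrow> complex^'n^'n"
  assumes M: "(M has_vector_derivative M') (at t)" and inv: "invertible (M t)"
  shows "((\<lambda>s. matrix_inv (M s)) has_vector_derivative
    - (matrix_inv (M t) ** M' ** matrix_inv (M t))) (at t)"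
proof -
  \<comment> \<open>Differentiable at \<open>t\<close> by its formula, and equal to the inverse
    wherever the determinant is nonzero, hence near \<open>t\<close>.\<close>
  define Q where "Q = (\<lambda>s. \<chi> k j.
    det (\<chi> i j'. if j' = k then axis j 1 $ i else M s $ i $ j') / det (M s))"
  have diffM: "(\<lambda>s. M s $ i $ j) differentiable (at t)" for i j
    using M by (intro differentiable_vec_nth) (auto simp: has_vector_derivative_def differentiable_def)
  have diff_if: "(\<lambda>s. if b then c else M s $ i $ j) differentiable (at t)" for b c i j
    using diffM by (cases b) simp_all
  have diff_det: "(\<lambda>s. det (M s)) differentiable (at t)"
    by (intro differentiable_det diffM)
  have "Q differentiable (at t)"
    unfolding Q_def using inv
    by (intro differentiable_vecI)
      (auto intro!: differentiable_divide differentiable_det diff_if diffM simp: invertible_det_nz)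
  then obtain Q' where Q: "(Q has_vector_derivative Q') (at t)"
    by (auto simp: vector_derivative_works)
  have "((\<lambda>s. det (M s)) \<longlongrightarrow> det (M t)) (nhds t)"
    using differentiable_imp_continuous_within[OF diff_det]
    unfolding isCont_def by (rule tendsto_at_iff_tendsto_nhds[THEN iffD1])
  moreover have "det (M t) \<noteq> 0"
    using inv by (simp add: invertible_det_nz)
  ultimately have "eventually (\<lambda>s. det (M s) \<noteq> 0) (nhds t)"
    by (rule tendsto_imp_eventually_ne)
  then obtain N where N: "open N" "t \<in> N" "\<And>s. s \<in> N \<Longrightarrow> det (M s) \<noteq> 0"
    by (auto simp: eventually_nhds)
  have Q': "((\<lambda>s. matrix_inv (M s)) has_vector_derivative Q') (at t)"
    using Q N(1,2) by (rule has_vector_derivative_transform_within_open)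
      (simp add: Q_def vec_eq_iff matrix_inv_nth_cramer N(3))
  have "((\<lambda>s. matrix_inv (M s) ** M s) has_vector_derivative
      matrix_inv (M t) ** M' + Q' ** M t) (at t)"
    by (rule bounded_bilinear.has_vector_derivative[OF bounded_bilinear_matrix_mult Q' M])
  moreover have "((\<lambda>s. matrix_inv (M s) ** M s) has_vector_derivative 0) (at t)"
    using N by (intro has_vector_derivative_transform_within_open[OF has_vector_derivative_const])
      (auto simp: invertible_det_nz[symmetric] matrix_inv_left)
  ultimately have "matrix_inv (M t) ** M' + Q' ** M t = 0"
    by (rule vector_derivative_unique_at)
  then have "(matrix_inv (M t) ** M' + Q' ** M t) ** matrix_inv (M t) = 0"
    by simp
  then have "Q' = - (matrix_inv (M t) ** M' ** matrix_inv (M t))"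
    using inv unfolding bounded_bilinear.add_left[OF bounded_bilinear_matrix_mult]
    by (simp add: matrix_mul_assoc[symmetric] matrix_inv_right add_eq_0_iff)
  then show ?thesis
    using Q' by simp
qed

section \<open>Local differentiable square roots at a positive diagonal matrix\<close>

lemma herm_form_diag: "herm_form (diag_mat d) v = (\<Sum>i\<in>UNIV. d $ i * (cmod (v $ i))\<^sup>2)"
proof -
  have *: "cnj z * (of_real r * z) = of_real (r * (cmod z)\<^sup>2)" for z r
    by (simp only: of_real_mult complex_norm_square) (simp add: ac_simps)
  have "cnj (v $ i) * (diag_mat d *v v) $ i = of_real (d $ i * (cmod (v $ i))\<^sup>2)" for i
    by (simp add: matrix_vector_mult_def diag_mat_nth if_distrib[of "\<lambda>x. x * _"] cong: if_cong)
      (use * in simp)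
  then show ?thesis
    by (simp add: herm_form_def)
qed

text \<open>A crude bound: the form is a sum over all index pairs, and each term is at most
  \<open>norm v * (norm X * norm v)\<close>.\<close>

lemma abs_herm_form_le:
  fixes X :: "complex^'n^'n"
  shows "\<bar>herm_form X v\<bar> \<le> (real CARD('n))\<^sup>2 * norm X * (norm v)\<^sup>2"
proof -
  have "\<bar>herm_form X v\<bar> \<le> cmod (\<Sum>i\<in>UNIV. \<Sum>j\<in>UNIV. cnj (v $ i) * (X $ i $ j * v $ j))"
    unfolding herm_form_def matrix_vector_mult_def
    by (simp add: sum_distrib_left abs_Re_le_cmod del: Re_sum)
  also have "\<dots> \<le> (\<Sum>i\<in>(UNIV::'n set). \<Sum>j\<in>(UNIV::'n set). norm v * (norm X * norm v))"
  proof (intro order.trans[OF norm_sum] sum_mono)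
    fix i j
    have "cmod (X $ i $ j) \<le> norm X"
      using Finite_Cartesian_Product.norm_nth_le[of X i]
        Finite_Cartesian_Product.norm_nth_le[of "X $ i" j] by linarith
    then show "cmod (cnj (v $ i) * (X $ i $ j * v $ j)) \<le> norm v * (norm X * norm v)"
      by (simp add: norm_mult mult_mono Finite_Cartesian_Product.norm_nth_le)
  qed
  also have "\<dots> = (real CARD('n))\<^sup>2 * norm X * (norm v)\<^sup>2"
    by (simp add: power2_eq_square)
  finally show ?thesis .
qed

lemma herm_form_add: "herm_form (X + Y) v = herm_form X v + herm_form Y v"
  by (simp add: herm_form_def matrix_vector_mult_add_rdistrib distrib_left sum.distrib)

text \<open>The diagonal form is at least \<open>c * (norm v)\<^sup>2\<close> with \<open>c\<close>
  the smallest entry; the radius \<open>e\<close> is chosen so that the perturbation contributes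
  strictly less.\<close>

lemma posdef_near_diag:
  fixes d :: "real^'n"
  assumes d: "\<And>i. 0 < d $ i"
  obtains e where "0 < e" "\<And>X. X \<in> ball (diag_mat d) e \<Longrightarrow> hermitian X \<Longrightarrow> posdef X"
proof -
  define c where "c = Min (range (($) d))"
  have c: "0 < c" "\<And>i. c \<le> d $ i"
    using d by (auto simp: c_def)
  define e where "e = c / (real CARD('n))\<^sup>2"
  have e: "0 < e" "(real CARD('n))\<^sup>2 * e = c"
    using c by (auto simp: e_def)
  have "posdef X" if X: "X \<in> ball (diag_mat d) e" "hermitian X" for X
    unfolding posdef_def
  proof (intro conjI allI impI)
    fix v :: "complex^'n" assume v: "v \<noteq> 0"
    have "(real CARD('n))\<^sup>2 * norm (X - diag_mat d) < (real CARD('n))\<^sup>2 * e"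
      using X by (intro mult_strict_left_mono) (auto simp: dist_norm norm_minus_commute)
    then have "(real CARD('n))\<^sup>2 * norm (X - diag_mat d) * (norm v)\<^sup>2 < c * (norm v)\<^sup>2"
      using v e by (intro mult_strict_right_mono) auto
    then have "\<bar>herm_form (X - diag_mat d) v\<bar> < c * (norm v)\<^sup>2"
      using abs_herm_form_le[of "X - diag_mat d" v] by linarith
    also have "c * (norm v)\<^sup>2 \<le> herm_form (diag_mat d) v"
      unfolding herm_form_diag
      by (auto simp: norm_vec_def L2_set_def sum_nonneg sum_distrib_left intro!: sum_mono
          mult_right_mono c)
    finally show "0 < herm_form X v"
      using herm_form_add[of "X - diag_mat d" "diag_mat d" v] by simp
  qed (use X in simp)
  with e(1) show ?thesis
    by (rule that)
qed

lemma hermitian_diag: "hermitian (diag_mat d)"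
  by (simp add: hermitian_def vec_eq_iff diag_mat_nth)

text \<open>
  The derivative \<open>H \<mapsto> D H + H D\<close> of squaring at a diagonal matrix \<open>D\<close> multiplies the entry
  \<open>(i, j)\<close> by \<open>d\<^sub>i + d\<^sub>j\<close>, so the inverse function theorem applies; local injectivity forces the
  root of a Hermitian matrix to be Hermitian, because its adjoint is another nearby root.
\<close>

lemma square_local_inverse:
  fixes d :: "real^'n"
  assumes d: "\<And>i. 0 < d $ i"
  obtains V g where "open V" "diag_mat d ** diag_mat d \<in> V"
    and "g (diag_mat d ** diag_mat d) = diag_mat d"
    and "\<And>Y. Y \<in> V \<Longrightarrow> g differentiable (at Y)"
    and "\<And>Y. Y \<in> V \<Longrightarrow> g Y ** g Y = Y"
    and "\<And>Y. Y \<in> V \<Longrightarrow> hermitian Y \<Longrightarrow> posdef (g Y)"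
proof -
  define f :: "complex^'n^'n \<Rightarrow> complex^'n^'n" where "f = (\<lambda>X. X ** X)"
  interpret mm: bounded_bilinear "(**) :: complex^'n^'n \<Rightarrow> complex^'n^'n \<Rightarrow> complex^'n^'n"
    by (rule bounded_bilinear_matrix_mult)
  define f' :: "complex^'n^'n \<Rightarrow> (complex^'n^'n) \<Rightarrow>\<^sub>L (complex^'n^'n)"
    where "f' = (\<lambda>X. mm.prod_left X + mm.prod_right X)"
  have f': "blinfun_apply (f' X) H = X ** H + H ** X" for X H
    by (simp add: f'_def blinfun.add_left)
  let ?D = "diag_mat d"
  \<comment> \<open>The inverse of the derivative of squaring at \<open>?D\<close>; its denominators
    are positive.\<close>
  define L :: "complex^'n^'n \<Rightarrow> complex^'n^'n"
    where "L = (\<lambda>H. \<chi> i j. H $ i $ j / of_real (d $ i + d $ j))"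
  have "linear L"
    by (intro linearI) (simp_all add: L_def vec_eq_iff add_divide_distrib scaleR_conv_of_real)
  then have L: "bounded_linear L"
    by (simp add: linear_conv_bounded_linear)
  have dd: "complex_of_real (d $ i) + complex_of_real (d $ j) \<noteq> 0" for i j
    using d[of i] d[of j] by (metis add_pos_pos less_irrefl of_real_add of_real_eq_0_iff)
  have "Blinfun L o\<^sub>L f' ?D = id_blinfun"
  proof (rule blinfun_eqI)
    fix H
    show "blinfun_apply (Blinfun L o\<^sub>L f' ?D) H = blinfun_apply id_blinfun H"
      using dd unfolding blinfun_apply_blinfun_compose bounded_linear_Blinfun_apply[OF L] f'
      by (simp add: L_def vec_eq_iff diag_mat_mult_nth mult_diag_mat_nth field_simps)
  qed
  moreover have "(f has_derivative blinfun_apply (f' X)) (at X)" for X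
    unfolding f_def
    by (rule has_derivative_eq_rhs[OF mm.FDERIV[OF has_derivative_ident has_derivative_ident]])
      (simp add: fun_eq_iff f')
  moreover have "continuous_on UNIV f'"
    unfolding f'_def by (intro continuous_intros mm.bounded_linear_prod_left[THEN linear_continuous_on]
        mm.bounded_linear_prod_right[THEN linear_continuous_on])
  ultimately obtain U' V g g' where "open U'" "?D \<in> U'" "open V" "f ?D \<in> V"
    and hom: "homeomorphism U' V f g" and g': "\<And>y. y \<in> V \<Longrightarrow> (g has_derivative (g' y)) (at y)"
    using inverse_function_theorem[of UNIV f f' ?D "Blinfun L"] by (metis UNIV_I open_UNIV)
  have gf: "g (f X) = X" if "X \<in> U'" for X
    using hom that by (simp add: homeomorphism_apply1)
  have fg: "f (g Y) = Y" "g Y \<in> U'" if "Y \<in> V" for Y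
    using hom that by (auto simp: homeomorphism_def)
  obtain e where e: "0 < e" "\<And>X. X \<in> ball ?D e \<Longrightarrow> hermitian X \<Longrightarrow> posdef X"
    using posdef_near_diag[OF d] by blast
  \<comment> \<open>Two demands on a root: its adjoint stays in \<open>U'\<close>, where squaring is
    injective, and it is close enough to \<open>?D\<close> to be positive definite once
    Hermitian.\<close>
  define W where "W = dagger -` U' \<inter> ball ?D e"
  have "open (dagger -` U')"
    using \<open>open U'\<close> by (intro open_vimage linear_continuous_on bounded_linear_dagger)
  then have "open W"
    unfolding W_def by auto
  define V' where "V' = V \<inter> g -` W"
  have "open V'"
    unfolding V'_def using hom \<open>open V\<close> \<open>open W\<close>
    by (intro continuous_open_preimage) (simp_all add: homeomorphism_def)
  moreover have gD: "g (?D ** ?D) = ?D"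
    using gf[OF \<open>?D \<in> U'\<close>] by (simp add: f_def)
  moreover have "?D ** ?D \<in> V'"
    using \<open>f ?D \<in> V\<close> \<open>?D \<in> U'\<close> e(1) hermitian_diag[of d]
    unfolding V'_def W_def hermitian_def by (simp add: f_def gD)
  moreover have "g differentiable (at Y)" "g Y ** g Y = Y" if "Y \<in> V'" for Y
    using that fg(1) g' by (auto simp: V'_def f_def differentiable_def)
  moreover have "posdef (g Y)" if Y: "Y \<in> V'" "hermitian Y" for Y
  proof (rule e(2))
    \<comment> \<open>The adjoint of the root squares to \<open>dagger Y = Y\<close>, so injectivity
      on \<open>U'\<close> identifies it with the root.\<close>
    have "f (dagger (g Y)) = Y"
      using Y fg(1)[of Y] by (simp add: f_def V'_def hermitian_def flip: dagger_mult)
    moreover have "dagger (g Y) \<in> U'"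
      using Y by (simp add: V'_def W_def)
    ultimately show "hermitian (g Y)"
      using gf unfolding hermitian_def by metis
    show "g Y \<in> ball ?D e"
      using Y by (simp add: V'_def W_def)
  qed
  ultimately show ?thesis
    using that[of V' g] by blast
qed

section \<open>The trace norm along a Hermitian curve\<close>

lemma trace_norm_eqI:
  assumes "posdef R" "R ** R = dagger X ** X"
  shows "complex_of_real (trace_norm X) = trace R"
  using assms
  by (simp add: trace_norm_def psd_sqrt_eqI trace_hermitian_real posdef_def)

text \<open>Traces are complex while the trace norm is real; this transfers derivatives between the
  two. Uniqueness of the derivative shows that \<open>X\<close> is real.\<close>

lemma has_real_derivative_of_complex:
  assumes "((\<lambda>s. complex_of_real (f s)) has_vector_derivative X) (at t)"
  shows "(f has_real_derivative Re X) (at t)" "complex_of_real (Re X) = X"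
proof -
  show *: "(f has_real_derivative Re X) (at t)"
    using bounded_linear.has_vector_derivative[OF bounded_linear_Re assms]
    by (simp add: has_real_derivative_iff_has_vector_derivative)
  have "((\<lambda>s. complex_of_real (f s)) has_vector_derivative complex_of_real (Re X)) (at t)"
    using * bounded_linear.has_vector_derivative[OF bounded_linear_of_real]
    by (simp add: has_real_derivative_iff_has_vector_derivative)
  then show "complex_of_real (Re X) = X"
    using assms by (rule vector_derivative_unique_at)
qed

lemma trace_conjugate_unitary:
  assumes "unitary U"
  shows "trace (U ** X ** dagger U) = trace X"
  using assms trace_mul_sym[of "U ** X" "dagger U"]
  by (simp add: matrix_mul_assoc unitary_def)

text \<open>For nonzero entries \<open>l\<^sub>i \<noteq> l\<^sub>j\<close> this is the divided difference \<open>(sgn l\<^sub>i - sgn l\<^sub>j) / (l\<^sub>i - l\<^sub>j)\<close>.\<close>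

definition sgn_quotient :: "real^'n \<Rightarrow> 'n \<Rightarrow> 'n \<Rightarrow> real"
  where "sgn_quotient l i j = (1 - sgn (l $ i) * sgn (l $ j)) / (\<bar>l $ i\<bar> + \<bar>l $ j\<bar>)"

text \<open>The left factor is the symmetrised weight of the inverse root; the squared quotient is
  the square of the factor by which the entries of \<open>R'\<close> differ from those of
  \<open>A'\<close>.\<close>

lemma sgn_quotient_identity:
  fixes a b :: real
  assumes "a \<noteq> 0" "b \<noteq> 0"
  shows "(1 / \<bar>a\<bar> + 1 / \<bar>b\<bar>) * (1 - ((a + b) / (\<bar>a\<bar> + \<bar>b\<bar>))\<^sup>2)
    = 2 * ((1 - sgn a * sgn b) / (\<bar>a\<bar> + \<bar>b\<bar>))"
proof -
  have s: "\<bar>a\<bar> + \<bar>b\<bar> \<noteq> 0"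
    using assms by linarith
  have "(1 / \<bar>a\<bar> + 1 / \<bar>b\<bar>) * (1 - ((a + b) / (\<bar>a\<bar> + \<bar>b\<bar>))\<^sup>2)
      = ((\<bar>a\<bar> + \<bar>b\<bar>)\<^sup>2 - (a + b)\<^sup>2) / (\<bar>a\<bar> * \<bar>b\<bar> * (\<bar>a\<bar> + \<bar>b\<bar>))"
    using assms s by (simp add: divide_simps power2_eq_square)
  \<comment> \<open>The difference of squares is \<open>2 * (\<bar>a * b\<bar> - a * b)\<close>, and
    \<open>a * b\<close> is its absolute value times the two signs.\<close>
  also have "(\<bar>a\<bar> + \<bar>b\<bar>)\<^sup>2 - (a + b)\<^sup>2 = 2 * (\<bar>a\<bar> * \<bar>b\<bar> * (1 - sgn a * sgn b))"
    using assms by (cases "a > 0"; cases "b > 0") (auto simp: power2_eq_square algebra_simps)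
  finally show ?thesis
    using assms by simp
qed

lemma has_vector_derivative_matrix_mult:
  fixes F :: "real \<Rightarrow> complex^'n^'m" and G :: "real \<Rightarrow> complex^'p^'n"
  assumes "(F has_vector_derivative F') (at t)" "(G has_vector_derivative G') (at t)"
  shows "((\<lambda>s. F s ** G s) has_vector_derivative F t ** G' + F' ** G t) (at t)"
  by (rule bounded_bilinear.has_vector_derivative[OF bounded_bilinear_matrix_mult assms])

text \<open>A zero eigenvalue would put the nonzero vector \<open>U *v axis i 1\<close> into the
  kernel of \<open>X\<close>.\<close>

lemma eigenvalues_nonzero:
  assumes inv: "invertible X" and U: "unitary U" and X: "X = U ** diag_mat l ** dagger U"
  shows "l $ i \<noteq> 0"
proof
  have UU: "dagger U ** U = mat 1"
    using U by (simp add: unitary_def)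
  assume "l $ i = 0"
  then have "diag_mat l *v axis i 1 = 0"
    by (auto simp: vec_eq_iff matrix_vector_mult_def diag_mat_nth axis_def intro!: sum.neutral)
  then have "X *v (U *v axis i 1) = 0"
    by (simp add: X matrix_vector_mul_assoc matrix_mul_assoc[symmetric] UU)
      (simp add: matrix_vector_mul_assoc[symmetric])
  then have "U *v axis i 1 = 0"
    using inv unfolding invertible_left_inverse matrix_left_invertible_ker by blast
  then have "dagger U *v (U *v axis i 1) = 0"
    by simp
  then show False
    by (simp add: matrix_vector_mul_assoc UU)
qed

text \<open>The algebra at \<open>t0\<close>: \<open>A1\<close>, \<open>A2\<close>,
  \<open>R1\<close> stand for derivatives of the curve and of its root, and \<open>Q\<close> is the
  inverse of \<open>R\<close>. The left side is the product rule for half the trace of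
  \<open>Q ** (A ** A1 + A1 ** A)\<close>, with \<open>- (Q ** R1 ** Q)\<close> as the derivative of
  \<open>Q\<close>.\<close>

lemma trace_second_derivative_diag:
  fixes l :: "real^'n" and R1 A1 A2 :: "complex^'n^'n"
  defines "A \<equiv> diag_mat l" and "R \<equiv> abs_diag l" and "Q \<equiv> diag_mat (\<chi> i. 1 / \<bar>l $ i\<bar>)"
  assumes l: "\<And>i. l $ i \<noteq> 0"
    and R1: "R ** R1 + R1 ** R = A ** A1 + A1 ** A"
  shows "trace (Q ** (2 *\<^sub>R (A1 ** A1) + (A ** A2 + A2 ** A)) - Q ** R1 ** Q ** (A ** A1 + A1 ** A)) / 2
    = (\<Sum>i\<in>UNIV. \<Sum>j\<in>UNIV. of_real (sgn_quotient l i j) * (A1 $ i $ j * A1 $ j $ i))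
      + (\<Sum>i\<in>UNIV. of_real (sgn (l $ i)) * A2 $ i $ i)"
proof -
  have QR: "Q ** R = mat 1" "R ** Q = mat 1"
    using l by (simp_all add: Q_def R_def abs_diag_def vec_eq_iff diag_mat_mult_nth diag_mat_nth mat_def)
  \<comment> \<open>With \<open>R\<close> and \<open>A\<close> diagonal, the Sylvester equation
    \<open>R1\<close> decouples into scalar equations.\<close>
  have R1n: "R1 $ i $ j = of_real ((l $ i + l $ j) / (\<bar>l $ i\<bar> + \<bar>l $ j\<bar>)) * A1 $ i $ j" for i j
  proof -
    have "complex_of_real (\<bar>l $ i\<bar> + \<bar>l $ j\<bar>) \<noteq> 0"
      unfolding of_real_eq_0_iff using l[of i] by linarith
    moreover have "(R ** R1 + R1 ** R) $ i $ j = (A ** A1 + A1 ** A) $ i $ j"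
      by (simp only: R1)
    then have "of_real (\<bar>l $ i\<bar> + \<bar>l $ j\<bar>) * R1 $ i $ j = of_real (l $ i + l $ j) * A1 $ i $ j"
      by (simp add: R_def A_def abs_diag_def diag_mat_mult_nth mult_diag_mat_nth algebra_simps)
    ultimately show ?thesis
      by (simp add: nonzero_eq_divide_eq mult.commute)
  qed
  have RQ': "R ** (Q ** Z) = Z" "Q ** (R ** Z) = Z" for Z :: "complex^'n^'n"
    by (simp_all add: QR matrix_mul_assoc)
  \<comment> \<open>Replacing \<open>A ** A1 + A1 ** A\<close> by \<open>R ** R1 + R1 ** R\<close>
    gives two terms, equal by cyclicity of the trace.\<close>
  have "trace (Q ** R1 ** Q ** (A ** A1 + A1 ** A))
      = trace (Q ** R1 ** R1) + trace ((Q ** R1 ** Q ** R1) ** R)"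
    by (simp add: R1[symmetric] matrix_add_ldistrib trace_add matrix_mul_assoc[symmetric] RQ')
  also have "trace ((Q ** R1 ** Q ** R1) ** R) = trace (R1 ** (Q ** R1))"
    by (subst trace_mul_sym) (simp add: matrix_mul_assoc[symmetric] RQ')
  also have "\<dots> = trace (Q ** R1 ** R1)"
    by (rule trace_mul_sym)
  finally have tr: "trace (Q ** R1 ** Q ** (A ** A1 + A1 ** A)) = 2 * trace (Q ** R1 ** R1)"
    by simp
  define G where "G = (\<lambda>i j. A1 $ i $ j * A1 $ j $ i - R1 $ i $ j * R1 $ j $ i)"
  define q where "q = (\<lambda>i. complex_of_real (1 / \<bar>l $ i\<bar>))"
  have QZ: "trace (Q ** Z ** Z) = (\<Sum>i\<in>UNIV. \<Sum>j\<in>UNIV. q i * (Z $ i $ j * Z $ j $ i))" for Z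
    by (simp add: trace_def matrix_mul_assoc[symmetric] Q_def diag_mat_mult_nth q_def)
      (simp add: matrix_matrix_mult_def sum_distrib_left sum_divide_distrib)
  have qG: "(q i + q j) * G i j
      = 2 * (of_real (sgn_quotient l i j) * (A1 $ i $ j * A1 $ j $ i))" for i j
  proof -
    have "G i j = of_real (1 - ((l $ i + l $ j) / (\<bar>l $ i\<bar> + \<bar>l $ j\<bar>))\<^sup>2) * (A1 $ i $ j * A1 $ j $ i)"
      unfolding G_def R1n
      by (simp only: add.commute[of "l $ j" "l $ i"] add.commute[of "\<bar>l $ j\<bar>" "\<bar>l $ i\<bar>"]
          of_real_diff of_real_1 of_real_power) (simp only: power2_eq_square ring_distribs ac_simps mult_1_left)
    moreover have "(q i + q j) * of_real (1 - ((l $ i + l $ j) / (\<bar>l $ i\<bar> + \<bar>l $ j\<bar>))\<^sup>2)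
        = complex_of_real (2 * sgn_quotient l i j)"
      unfolding q_def sgn_quotient_def sgn_quotient_identity[OF l l, symmetric] by simp
    ultimately show ?thesis
      by (simp add: mult.assoc[symmetric])
  qed
  have "2 * (trace (Q ** A1 ** A1) - trace (Q ** R1 ** R1))
      = (\<Sum>i\<in>UNIV. \<Sum>j\<in>UNIV. q i * G i j) + (\<Sum>i\<in>UNIV. \<Sum>j\<in>UNIV. q i * G i j)"
    by (simp add: QZ G_def right_diff_distrib sum_subtractf)
  \<comment> \<open>\<open>G\<close> is symmetric, so exchanging the indices in one copy turns its
    weight \<open>q i\<close> into \<open>q j\<close>.\<close>
  also have "\<dots> = (\<Sum>i\<in>UNIV. \<Sum>j\<in>UNIV. q i * G i j) + (\<Sum>i\<in>UNIV. \<Sum>j\<in>UNIV. q j * G i j)"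
    by (intro arg_cong2[where f="(+)"] refl, subst sum.swap) (simp add: G_def mult.commute)
  also have "\<dots> = (\<Sum>i\<in>UNIV. \<Sum>j\<in>UNIV. (q i + q j) * G i j)"
    by (simp add: distrib_right sum.distrib)
  also have "\<dots> = (\<Sum>i\<in>UNIV. \<Sum>j\<in>UNIV. 2 * (of_real (sgn_quotient l i j) * (A1 $ i $ j * A1 $ j $ i)))"
    by (simp only: qG)
  finally have quad: "trace (Q ** A1 ** A1) - trace (Q ** R1 ** R1)
      = (\<Sum>i\<in>UNIV. \<Sum>j\<in>UNIV. of_real (sgn_quotient l i j) * (A1 $ i $ j * A1 $ j $ i))"
    by (simp only: sum_distrib_left[symmetric] mult_cancel_left) simp
  have "(Q ** (A ** A2)) $ i $ i = of_real (sgn (l $ i)) * A2 $ i $ i"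
    "(Q ** (A2 ** A)) $ i $ i = of_real (sgn (l $ i)) * A2 $ i $ i" for i
    by (simp_all add: Q_def A_def diag_mat_mult_nth mult_diag_mat_nth sgn_if l)
  then have lin: "trace (Q ** (A ** A2 + A2 ** A)) = 2 * (\<Sum>i\<in>UNIV. of_real (sgn (l $ i)) * A2 $ i $ i)"
    unfolding trace_def matrix_add_ldistrib vector_add_component sum.distrib by simp
  have "trace (Q ** (2 *\<^sub>R (A1 ** A1))) = 2 * trace (Q ** A1 ** A1)"
    unfolding scaleR_2 matrix_add_ldistrib trace_add matrix_mul_assoc by simp
  then show ?thesis
    unfolding trace_sub matrix_add_ldistrib[of Q "2 *\<^sub>R (A1 ** A1)"] trace_add lin tr quad[symmetric]
    by (simp add: diff_divide_distrib add_divide_distrib)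
qed

text \<open>The first derivative \<open>f\<close> is provided on a whole neighbourhood
  \<open>T\<close>, so that it can be differentiated again at \<open>t0\<close>.\<close>

lemma trace_norm_twice_differentiable:
  fixes X X1 X2 :: "real \<Rightarrow> complex^'n^'n" and l :: "real^'n"
  assumes S: "open S" "t0 \<in> S"
    and herm: "\<And>t. t \<in> S \<Longrightarrow> hermitian (X t)"
    and X1: "\<And>t. t \<in> S \<Longrightarrow> (X has_vector_derivative X1 t) (at t)"
    and X2: "\<And>t. t \<in> S \<Longrightarrow> (X1 has_vector_derivative X2 t) (at t)"
    and inv: "invertible (X t0)" and U: "unitary U" and X0: "X t0 = U ** diag_mat l ** dagger U"
  obtains T f D where "open T" "t0 \<in> T"
    and "\<And>t. t \<in> T \<Longrightarrow> ((\<lambda>s. trace_norm (X s)) has_real_derivative f t) (at t)"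
    and "(f has_real_derivative D) (at t0)"
    and "complex_of_real D = (\<Sum>i\<in>UNIV. \<Sum>j\<in>UNIV. of_real (sgn_quotient l i j)
          * ((dagger U ** X1 t0 ** U) $ i $ j * (dagger U ** X1 t0 ** U) $ j $ i))
        + (\<Sum>i\<in>UNIV. of_real (sgn (l $ i)) * (dagger U ** X2 t0 ** U) $ i $ i)"
proof -
  define A where "A = (\<lambda>t. dagger U ** X t ** U)"
  define A1 where "A1 = (\<lambda>t. dagger U ** X1 t ** U)"
  define A2 where "A2 = (\<lambda>t. dagger U ** X2 t ** U)"
  have UU: "dagger U ** U = mat 1" "U ** dagger U = mat 1"
    "dagger U ** (U ** Z) = Z" "U ** (dagger U ** Z) = Z" for Z :: "complex^'n^'n"
    using U by (simp_all add: unitary_def matrix_mul_assoc)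
  have conj: "((\<lambda>t. dagger U ** F t ** U) has_vector_derivative dagger U ** F' ** U) (at t)"
    if "(F has_vector_derivative F') (at t)" for F F' t
    using has_vector_derivative_matrix_mult[OF has_vector_derivative_matrix_mult[OF
        has_vector_derivative_const that] has_vector_derivative_const[of U]]
    by (simp add: bounded_bilinear.zero_left[OF bounded_bilinear_matrix_mult]
        bounded_bilinear.zero_right[OF bounded_bilinear_matrix_mult])
  have A1: "(A has_vector_derivative A1 t) (at t)" and A2: "(A1 has_vector_derivative A2 t) (at t)"
    if "t \<in> S" for t
    using that unfolding A_def A1_def A2_def by (auto intro!: conj X1 X2)
  have A0: "A t0 = diag_mat l"
    by (simp add: A_def X0 matrix_mul_assoc[symmetric] UU)
  have hermA: "dagger (A t) = A t" if "t \<in> S" for t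
    using herm[OF that] by (simp add: A_def hermitian_def dagger_mult matrix_mul_assoc)
  have l: "l $ i \<noteq> 0" for i
    by (rule eigenvalues_nonzero[OF inv U X0])
  \<comment> \<open>The diagonal of \<bar>\<Lambda>\<bar>, the root of \<open>A t0 ** A t0\<close>
    at which the local inverse of squaring is taken.\<close>
  define d where "d = (\<chi> i. \<bar>l $ i\<bar>)"
  have "0 < d $ i" for i
    using l by (simp add: d_def)
  from square_local_inverse[OF this] obtain V g where V: "open V" "diag_mat d ** diag_mat d \<in> V"
    and g0: "g (diag_mat d ** diag_mat d) = diag_mat d"
    and g': "\<And>Y. Y \<in> V \<Longrightarrow> g differentiable (at Y)"
    and gg: "\<And>Y. Y \<in> V \<Longrightarrow> g Y ** g Y = Y"
    and gpos: "\<And>Y. Y \<in> V \<Longrightarrow> hermitian Y \<Longrightarrow> posdef (g Y)"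
    by blast
  define Y where "Y = (\<lambda>t. A t ** A t)"
  define C where "C = (\<lambda>t. A t ** A1 t + A1 t ** A t)"
  have Y': "(Y has_vector_derivative C t) (at t)" if "t \<in> S" for t
    unfolding Y_def C_def using A1[OF that] A1[OF that] by (rule has_vector_derivative_matrix_mult)
  have Y0: "Y t0 = diag_mat d ** diag_mat d"
    by (simp add: Y_def A0 d_def vec_eq_iff diag_mat_mult_nth diag_mat_nth flip: of_real_mult)
  define T where "T = S \<inter> Y -` V"
  have "continuous_on S Y"
    using Y' by (intro continuous_at_imp_continuous_on ballI has_vector_derivative_continuous)
  then have "open T"
    unfolding T_def using S(1) V(1) by (rule continuous_open_preimage)
  have T0: "t0 \<in> T"
    using S V by (simp add: T_def Y0)
  have TS: "t \<in> S" if "t \<in> T" for t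
    using that by (simp add: T_def)
  define R where "R = (\<lambda>t. g (Y t))"
  have RR: "R t ** R t = Y t" if "t \<in> T" for t
    using that gg by (simp add: R_def T_def)
  have posR: "posdef (R t)" if "t \<in> T" for t
    using that gpos hermA by (simp add: R_def T_def Y_def hermitian_def dagger_mult)
  have R0: "R t0 = abs_diag l"
    by (simp only: R_def Y0 g0) (simp only: abs_diag_def d_def)
  have "\<exists>R'. (R has_vector_derivative R') (at t)" if "t \<in> T" for t
  proof -
    have "R differentiable (at t)"
      unfolding R_def using that g' Y' differentiable_chain_at[of Y t g]
      by (auto simp: T_def o_def intro: differentiableI_vector)
    then show ?thesis
      by (auto simp: vector_derivative_works)
  qed
  then obtain R1 where R1: "\<And>t. t \<in> T \<Longrightarrow> (R has_vector_derivative R1 t) (at t)"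
    by metis
  \<comment> \<open>Both sides are derivatives of \<open>R s ** R s = Y s\<close>.\<close>
  have sylv: "R t ** R1 t + R1 t ** R t = C t" if "t \<in> T" for t
    using has_vector_derivative_matrix_mult[OF R1 R1, OF that that]
  proof (rule vector_derivative_unique_at)
    show "((\<lambda>s. R s ** R s) has_vector_derivative C t) (at t)"
      using Y'[OF TS[OF that]] \<open>open T\<close> that
      by (rule has_vector_derivative_transform_within_open) (simp add: RR)
  qed
  define Q where "Q = (\<lambda>t. matrix_inv (R t))"
  have QR: "Q t ** R t = mat 1" "R t ** Q t = mat 1" if "t \<in> T" for t
    using posdef_imp_invertible[OF posR[OF that]] by (simp_all add: Q_def matrix_inv_left matrix_inv_right)
  have tn: "complex_of_real (trace_norm (X t)) = trace (R t)" if "t \<in> T" for t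
  proof -
    have XA: "X t = U ** A t ** dagger U"
      by (simp add: A_def matrix_mul_assoc[symmetric] UU)
    \<comment> \<open>Conjugating back by \<open>U\<close> turns the root of \<open>Y t\<close> into
      a root of \<open>dagger (X t) ** X t\<close> with the same trace.\<close>
    have "(U ** R t ** dagger U) ** (U ** R t ** dagger U) = U ** (R t ** R t) ** dagger U"
      by (simp add: matrix_mul_assoc[symmetric] UU)
    also have "\<dots> = dagger (X t) ** X t"
      by (simp add: RR[OF that] Y_def XA dagger_mult hermA[OF TS[OF that]] matrix_mul_assoc[symmetric] UU)
    finally show ?thesis
      using trace_norm_eqI[OF posdef_conjugate[OF U posR[OF that]]] by (simp add: trace_conjugate_unitary[OF U])
  qed
  define f where "f = (\<lambda>t. Re (trace (R1 t)))"
  have tr: "trace (Q t ** C t) / 2 = trace (R1 t)" if "t \<in> T" for t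
  proof -
    \<comment> \<open>Multiplying the Sylvester equation by \<open>Q t\<close> makes both terms have
      trace \<open>trace (R1 t)\<close>, by cyclicity.\<close>
    have "trace (Q t ** C t) = trace (Q t ** R t ** R1 t) + trace ((Q t ** R1 t) ** R t)"
      by (simp add: sylv[OF that, symmetric] matrix_add_ldistrib trace_add matrix_mul_assoc)
    also have "trace ((Q t ** R1 t) ** R t) = trace ((R t ** Q t) ** R1 t)"
      by (subst trace_mul_sym) (simp add: matrix_mul_assoc)
    finally show ?thesis
      by (simp add: QR[OF that])
  qed
  have tn': "((\<lambda>s. complex_of_real (trace_norm (X s))) has_vector_derivative trace (R1 t)) (at t)"
    if "t \<in> T" for t
    using bounded_linear.has_vector_derivative[OF bounded_linear_trace R1[OF that]] \<open>open T\<close> that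
    by (rule has_vector_derivative_transform_within_open) (simp add: tn)
  have f: "((\<lambda>s. trace_norm (X s)) has_real_derivative f t) (at t)"
    and f_complex: "complex_of_real (f t) = trace (R1 t)" if "t \<in> T" for t
    unfolding f_def using has_real_derivative_of_complex[OF tn'[OF that]] by simp_all
  have Q': "(Q has_vector_derivative - (Q t0 ** R1 t0 ** Q t0)) (at t0)"
    unfolding Q_def by (intro has_vector_derivative_matrix_inv R1 T0 posdef_imp_invertible posR)
  have C': "(C has_vector_derivative 2 *\<^sub>R (A1 t0 ** A1 t0) + (A t0 ** A2 t0 + A2 t0 ** A t0)) (at t0)"
    unfolding C_def
    by (rule has_vector_derivative_eq_rhs[OF has_vector_derivative_add[OF
          has_vector_derivative_matrix_mult[OF A1 A2] has_vector_derivative_matrix_mult[OF A2 A1]]])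
      (simp_all add: S scaleR_2)
  let ?D = "trace (Q t0 ** (2 *\<^sub>R (A1 t0 ** A1 t0) + (A t0 ** A2 t0 + A2 t0 ** A t0))
    + - (Q t0 ** R1 t0 ** Q t0) ** C t0) / 2"
  have "((\<lambda>t. trace (Q t ** C t) / 2) has_vector_derivative ?D) (at t0)"
    by (intro bounded_linear.has_vector_derivative[OF bounded_linear_divide]
        bounded_linear.has_vector_derivative[OF bounded_linear_trace]
        has_vector_derivative_matrix_mult Q' C')
  \<comment> \<open>On \<open>T\<close> the function \<open>f\<close> equals
    \<open>trace (Q t ** C t) / 2\<close>, whose derivative involves only the first derivative of
    \<open>R\<close>.\<close>
  then have f': "((\<lambda>t. complex_of_real (f t)) has_vector_derivative ?D) (at t0)"
    using \<open>open T\<close> T0 by (rule has_vector_derivative_transform_within_open) (simp add: tr f_complex)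
  define D where "D = Re ?D"
  note fD = has_real_derivative_of_complex[OF f']
  have "Q t0 = diag_mat (\<chi> i. 1 / \<bar>l $ i\<bar>)"
  proof -
    have "abs_diag l ** diag_mat (\<chi> i. 1 / \<bar>l $ i\<bar>) = mat 1"
      using l by (simp add: abs_diag_def vec_eq_iff diag_mat_mult_nth diag_mat_nth mat_def)
    then have "Q t0 ** (R t0 ** diag_mat (\<chi> i. 1 / \<bar>l $ i\<bar>)) = Q t0"
      by (simp add: R0)
    then show ?thesis
      by (simp add: matrix_mul_assoc QR[OF T0])
  qed
  then have "?D = (\<Sum>i\<in>UNIV. \<Sum>j\<in>UNIV. of_real (sgn_quotient l i j) * (A1 t0 $ i $ j * A1 t0 $ j $ i))
      + (\<Sum>i\<in>UNIV. of_real (sgn (l $ i)) * A2 t0 $ i $ i)"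
    using trace_second_derivative_diag[OF l, of "R1 t0" "A1 t0" "A2 t0"] sylv[OF T0]
    by (simp add: R0 A0 C_def bounded_bilinear.minus_left[OF bounded_bilinear_matrix_mult])
  with fD(2) have "complex_of_real D = \<dots>"
    unfolding D_def by (rule trans)
  note D = this[unfolded A1_def A2_def]
  from that[OF \<open>open T\<close> T0 f fD(1)[folded D_def] D] show ?thesis .
qed

section \<open>Vectorisation and the matrices of the formula\<close>

text \<open>A permutation matrix that exchanges the second-factor indices of the two pairs.\<close>

lemma KB_mat_nth:
  "KB_mat $ p $ q
    = (if q = ((fst (fst p), snd (snd p)), (fst (snd p), snd (fst p))) then 1 else 0)"
proof -
  \<comment> \<open>The test is nested with \<open>j\<close> and \<open>i\<close> outermost so that
    both sums collapse.\<close>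
  have "kron (kron (mat 1) (unit_mat j i)) (kron (mat 1) (unit_mat i j)) $ p $ q
      = (if j = snd (fst p) then if i = snd (snd p) then
          if q = ((fst (fst p), snd (snd p)), (fst (snd p), snd (fst p))) then 1 else 0 else 0 else 0)"
    for i j
    by (cases p; cases q) (auto simp: kron_def unit_mat_def mat_def)
  then show ?thesis
    by (simp add: KB_mat_def)
qed

lemma KB_mat_vec_mat: "KB_mat *v vec_mat X = vec_mat (partial_transpose X)"
  by (simp add: vec_eq_iff matrix_vector_mult_def KB_mat_nth vec_mat_def partial_transpose_def
      if_distrib[of "\<lambda>x. x * _"] cong: if_cong)

lemma K_mat_nth: "K_mat $ p $ q = (if q = (snd p, fst p) then 1 else 0)"
proof -
  have "kron (unit_mat j i) (unit_mat i j) $ p $ q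
      = (if j = fst p then if i = snd p then if q = (snd p, fst p) then 1 else 0 else 0 else 0)"
    for i j
    by (cases p; cases q) (auto simp: kron_def unit_mat_def)
  then show ?thesis
    by (simp add: K_mat_def)
qed

lemma K_mat_vec_mat: "K_mat *v vec_mat X = vec_mat (transpose X)"
  by (simp add: vec_eq_iff matrix_vector_mult_def K_mat_nth vec_mat_def transpose_def
      if_distrib[of "\<lambda>x. x * _"] cong: if_cong)

lemma sum_UNIV_prod: "(\<Sum>q\<in>UNIV. h (fst q) (snd q)) = (\<Sum>i\<in>UNIV. \<Sum>j\<in>UNIV. h i j)"
  for h :: "'a::finite \<Rightarrow> 'b::finite \<Rightarrow> 'c::comm_monoid_add"
  by (simp add: sum.cartesian_product UNIV_Times_UNIV[symmetric] case_prod_unfold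
      del: UNIV_Times_UNIV)

text \<open>The standard vec identity; it has this form because column stacking puts the column
  index first.\<close>

lemma kron_vec_mat: "kron (transpose V) W *v vec_mat X = vec_mat (W ** X ** V)"
proof -
  have "(\<Sum>q\<in>UNIV. V $ fst q $ i * W $ j $ snd q * X $ snd q $ fst q) = (W ** X ** V) $ j $ i" for i j
    by (subst sum_UNIV_prod[of "\<lambda>a b. V $ a $ i * W $ j $ b * X $ b $ a"])
      (simp add: matrix_matrix_mult_def sum_distrib_left sum_distrib_right ac_simps)
  then show ?thesis
    by (simp add: vec_eq_iff matrix_vector_mult_def kron_def vec_mat_def transpose_def)
qed

lemma tdot_vec_mat: "tdot (vec_mat X) (vec_mat Y) = trace (transpose X ** Y)"
proof -
  have "tdot (vec_mat X) (vec_mat Y) = (\<Sum>i\<in>UNIV. \<Sum>j\<in>UNIV. X $ j $ i * Y $ j $ i)"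
    unfolding tdot_def vec_mat_def
    using sum_UNIV_prod[of "\<lambda>i j. X $ j $ i * Y $ j $ i"] by simp
  then show ?thesis
    by (simp add: trace_def matrix_matrix_mult_def transpose_def)
qed

lemma matrix_inv_unique:
  fixes A :: "'a::field^'n^'n"
  assumes "A ** B = mat 1"
  shows "matrix_inv A = B"
proof -
  have "invertible A"
    using assms by (auto simp: invertible_right_inverse)
  then have "matrix_inv A ** (A ** B) = B"
    by (simp add: matrix_mul_assoc matrix_inv_left)
  then show ?thesis
    by (simp add: assms)
qed

lemma matrix_inv_diag_mat:
  assumes "\<And>i. l $ i \<noteq> 0"
  shows "matrix_inv (diag_mat l) = diag_mat (\<chi> i. 1 / l $ i)"
  using assms by (intro matrix_inv_unique)
    (simp add: vec_eq_iff diag_mat_mult_nth diag_mat_nth mat_def)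

text \<open>Read right to left, the factors of \<open>H_mat\<close> pass to the eigenbasis, scale
  entries by \<open>sgn_quotient\<close>, pass back and transpose; this last transpose compensates
  for the one in \<open>tdot_vec_mat\<close>.\<close>

lemma H_mat_quadratic_form:
  assumes l: "\<And>i. l $ i \<noteq> 0"
  shows "tdot (vec_mat X) (H_mat U l *v vec_mat X)
    = (\<Sum>i\<in>UNIV. \<Sum>j\<in>UNIV. of_real (sgn_quotient l i j)
        * ((dagger U ** X ** U) $ i $ j * (dagger U ** X ** U) $ j $ i))"
proof -
  define B where "B = dagger U ** X ** U"
  define e where "e = (\<chi> p. \<bar>l $ fst p\<bar> + \<bar>l $ snd p\<bar>)"
  have e: "e $ p \<noteq> 0" for p
    using l[of "fst p"] by (simp add: e_def)
  have "kron (abs_diag l) (mat 1) + kron (mat 1) (abs_diag l) = diag_mat e"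
    by (auto simp: vec_eq_iff kron_def abs_diag_def diag_mat_nth e_def mat_def prod_eq_iff)
  then have inv: "matrix_inv (kron (abs_diag l) (mat 1) + kron (mat 1) (abs_diag l))
      = diag_mat (\<chi> p. 1 / e $ p)"
    using e by (simp add: matrix_inv_diag_mat)
  have num: "mat 1 - kron (sign_diag l) (sign_diag l)
      = diag_mat (\<chi> p. 1 - sgn (l $ fst p) * sgn (l $ snd p))"
    by (auto simp: vec_eq_iff kron_def sign_diag_def diag_mat_nth mat_def prod_eq_iff)
  have diag: "(diag_mat h *v v) $ p = of_real (h $ p) * v $ p" for h p and v :: "complex^'k"
    by (simp add: matrix_vector_mult_def diag_mat_nth if_distrib[of "\<lambda>x. x * _"] cong: if_cong)
  \<comment> \<open>The indices of \<open>sgn_quotient\<close> are reversed because the first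
    component of a pair is the column.\<close>
  define Y where "Y = (\<chi> i j. of_real (sgn_quotient l j i) * B $ i $ j)"
  have Y: "diag_mat (\<chi> p. 1 - sgn (l $ fst p) * sgn (l $ snd p)) *v
      (diag_mat (\<chi> p. 1 / e $ p) *v vec_mat B) = vec_mat Y"
    by (simp add: vec_eq_iff diag vec_mat_def Y_def sgn_quotient_def e_def)
  have cnjU: "cnj_mat U = transpose (dagger U)"
    by (simp add: dagger_def)
  have "H_mat U l *v vec_mat X = K_mat *v (kron (cnj_mat U) U *v vec_mat Y)"
    unfolding H_mat_def inv num
    by (simp only: matrix_vector_mul_assoc[symmetric] kron_vec_mat B_def[symmetric] Y)
  also have "\<dots> = vec_mat (transpose (U ** Y ** dagger U))"
    by (simp only: cnjU kron_vec_mat K_mat_vec_mat)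
  finally have "tdot (vec_mat X) (H_mat U l *v vec_mat X)
      = trace (transpose X ** transpose (U ** Y ** dagger U))"
    by (simp add: tdot_vec_mat)
  also have "\<dots> = trace ((U ** Y) ** (dagger U ** X))"
    by (simp add: matrix_transpose_mul[symmetric] matrix_mul_assoc) (simp add: trace_def transpose_def)
  also have "\<dots> = trace (B ** Y)"
    by (subst trace_mul_sym) (simp add: B_def matrix_mul_assoc)
  also have "\<dots> = (\<Sum>i\<in>UNIV. \<Sum>j\<in>UNIV. of_real (sgn_quotient l i j) * (B $ i $ j * B $ j $ i))"
    by (simp add: trace_def matrix_matrix_mult_def Y_def ac_simps)
  finally show ?thesis
    by (simp only: B_def)
qed

text \<open>The first matrix is the transpose of \<open>U ** sign_diag l ** dagger U\<close>, so the
  pairing is a trace against the sign of the matrix; cyclicity moves it to the eigenbasis.\<close>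

lemma sign_linear_form:
  "tdot (vec_mat (cnj_mat U ** sign_diag l ** transpose U)) (vec_mat X)
    = (\<Sum>i\<in>UNIV. of_real (sgn (l $ i)) * (dagger U ** X ** U) $ i $ i)"
proof -
  have "transpose (sign_diag l) = sign_diag l"
    by (simp add: vec_eq_iff transpose_def sign_diag_def diag_mat_nth)
  then have "transpose (cnj_mat U ** sign_diag l ** transpose U) = U ** (sign_diag l ** dagger U)"
    by (simp add: matrix_transpose_mul dagger_def)
  then have "tdot (vec_mat (cnj_mat U ** sign_diag l ** transpose U)) (vec_mat X)
      = trace (U ** (sign_diag l ** dagger U ** X))"
    by (simp add: tdot_vec_mat matrix_mul_assoc)
  also have "\<dots> = trace (sign_diag l ** (dagger U ** X ** U))"
    by (subst trace_mul_sym) (simp add: matrix_mul_assoc)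
  finally show ?thesis
    by (simp add: trace_def sign_diag_def diag_mat_mult_nth)
qed

section \<open>The second derivative of the negativity\<close>

text \<open>\<open>deriv\<close> is total, so differentiability near \<open>t0\<close>, and of the
  derivative at \<open>t0\<close>, is asserted separately. The equation over the complex numbers
  also says that the right side is real.\<close>

theorem mainTheorem2:
  fixes \<rho> \<rho>1 \<rho>2 :: "real \<Rightarrow> complex^('a::finite \<times> 'b::finite)^('a \<times> 'b)"
    and S :: "real set" and t0 :: real
    and U :: "complex^('a \<times> 'b)^('a \<times> 'b)" and l :: "real^('a \<times> 'b)"
  assumes "open S" and "t0 \<in> S"
    and "\<And>t. t \<in> S \<Longrightarrow> density_matrix (\<rho> t)"
    and "\<And>t. t \<in> S \<Longrightarrow> (\<rho> has_vector_derivative \<rho>1 t) (at t)"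
    and "\<And>t. t \<in> S \<Longrightarrow> (\<rho>1 has_vector_derivative \<rho>2 t) (at t)"
    and "invertible (partial_transpose (\<rho> t0))"
    and "unitary U"
    and "partial_transpose (\<rho> t0) = U ** diag_mat l ** dagger U"
  shows "(\<forall>\<^sub>F t in nhds t0. (\<lambda>s. negativity (\<rho> s)) differentiable (at t))
    \<and> deriv (\<lambda>s. negativity (\<rho> s)) differentiable (at t0)
    \<and> complex_of_real (deriv (deriv (\<lambda>s. negativity (\<rho> s))) t0) =
        1/2 * tdot (KB_mat *v vec_mat (\<rho>1 t0)) (H_mat U l *v (KB_mat *v vec_mat (\<rho>1 t0)))
        + 1/2 * tdot (vec_mat (cnj_mat U ** sign_diag l ** transpose U))
            (KB_mat *v vec_mat (\<rho>2 t0))"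
proof -
  let ?X = "\<lambda>t. partial_transpose (\<rho> t)"
  let ?X1 = "\<lambda>t. partial_transpose (\<rho>1 t)" and ?X2 = "\<lambda>t. partial_transpose (\<rho>2 t)"
  let ?N = "\<lambda>s. negativity (\<rho> s)"
  \<comment> \<open>Partial transposition is linear, so it commutes with both derivatives in
    \<open>t\<close>.\<close>
  note pt' = bounded_linear.has_vector_derivative[OF bounded_linear_partial_transpose]
  have "hermitian (?X t)" if "t \<in> S" for t
    using assms(3)[OF that]
    by (simp add: density_matrix_def psd_def hermitian_partial_transpose)
  then obtain T f D where T: "open T" "t0 \<in> T"
    and f: "\<And>t. t \<in> T \<Longrightarrow> ((\<lambda>s. trace_norm (?X s)) has_real_derivative f t) (at t)"
    and D: "(f has_real_derivative D) (at t0)"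
    and D_eq: "complex_of_real D
      = (\<Sum>i\<in>UNIV. \<Sum>j\<in>UNIV. of_real (sgn_quotient l i j)
          * ((dagger U ** ?X1 t0 ** U) $ i $ j * (dagger U ** ?X1 t0 ** U) $ j $ i))
        + (\<Sum>i\<in>UNIV. of_real (sgn (l $ i)) * (dagger U ** ?X2 t0 ** U) $ i $ i)"
    using trace_norm_twice_differentiable[OF assms(1,2) _ pt'[OF assms(4)] pt'[OF assms(5)] assms(6-8)]
    by blast
  have l: "l $ i \<noteq> 0" for i
    by (rule eigenvalues_nonzero[OF assms(6-8)])
  have N: "(?N has_real_derivative f t / 2) (at t)" if "t \<in> T" for t
    unfolding negativity_def using f[OF that] by (auto intro!: derivative_eq_intros)
  have "eventually (\<lambda>t. ?N differentiable (at t)) (nhds t0)"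
    using T N unfolding eventually_nhds by (metis real_differentiable_def)
  moreover have "((\<lambda>t. f t / 2) has_real_derivative D / 2) (at t0)"
    using D by (auto intro!: derivative_eq_intros)
  \<comment> \<open>\<open>deriv ?N\<close> agrees with \<open>f t / 2\<close> on the open set
    \<open>T\<close>, which suffices for its derivative at \<open>t0\<close>.\<close>
  then have dN: "(deriv ?N has_real_derivative D / 2) (at t0)"
    using T by (rule has_field_derivative_transform_within_open) (simp add: DERIV_imp_deriv[OF N])
  then have "deriv ?N differentiable (at t0)"
    by (metis real_differentiable_def)
  moreover have "complex_of_real (deriv (deriv ?N) t0) = 1/2 * complex_of_real D"
    by (simp add: DERIV_imp_deriv[OF dN])
  ultimately show ?thesis
    by (simp only: D_eq KB_mat_vec_mat H_mat_quadratic_form[OF l] sign_linear_form ring_distribs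
        simp_thms)
qed

end
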